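(* Let $G = \mathbb{R} \rtimes \mathbb{R}^{+}$ be the "$ax+b$ group" consisting of all maps $\mathbb{R} \to \mathbb{R}$ of the form $x \mapsto ax+b$ for constants $a, b \in \mathbb{R}$ with $a > 0$. Let $\lambda$ be a probability measure on $\mathbb{R}$ in the measure class of Lebesgue measure. Then the natural action of $G$ on $(\mathbb{R},\lambda)$ is contractive, but $(\mathbb{R},\lambda)$ is not a quotient of the Poisson boundary of $(G,\mu)$ for any symmetric probability measure $\mu$ on $G$ that is nonsingular with respect to the Haar measure of $G$ and whose support generates $G$.
   Context: A $G$-space is a standard Borel probability space $(X,\nu)$ with a measurable action of the locally compact second countable group $G$ such that $\nu$ is quasi-invariant (the class of null sets is preserved by the action). A $G$-map $\pi:(X,\nu)\to(Y,\eta)$ of $G$-spaces is a measurable map with $\pi_*\nu=\eta$ and $\pi(gx)=g\pi(x)$ for all $g\in G$ and almost every $x\in X$; in this case $(Y,\eta)$ is called a quotient of $(X,\nu)$. A $G$-space $(X,\nu)$ is contractive when for every measurable set $B\subseteq X$ with $\nu(B)>0$ one has $\sup_{g\in G}\nu(gB)=1$. A probability measure $\mu$ on $G$ is symmetric when it is invariant under $g\mapsto g^{-1}$. For such a $\mu$ (with support generating $G$ and nonsingular with respect to Haar measure), consider the random walk with law $\mu$: the space $(G^{\mathbb{N}},\mu^{\mathbb{N}})$ on which $G$ acts by multiplication on the left of the first coordinate. The map $T:G^{\mathbb{N}}\to G^{\mathbb{N}}$, $T(\omega_1,\omega_2,\omega_3,\ldots)=(\omega_1\omega_2,\omega_3,\ldots)$,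 commutes with the $G$-action. The Poisson boundary of $(G,\mu)$ is the space of $T$-ergodic components (with the image of $\mu^{\mathbb{N}}$), a $G$-space. *)

theory Defs
  imports
    "HOL-Probability.Probability"
    "HOL-Algebra.Group_Action"
    "HOL-Algebra.Generated_Groups"
begin

subsection \<open>Locally compact second countable groups\<close>

definition borel_of :: "'a topology \<Rightarrow> 'a measure" where
  "borel_of X = sigma (topspace X) {U. openin X U}"

text \<open>A topological group is a monoid record \<open>G\<close> together with a topology \<open>X\<close> on its carrier.\<close>

definition lcsc_group :: "('g, 'm) monoid_scheme \<Rightarrow> 'g topology \<Rightarrow> bool" where
  "lcsc_group G X \<longleftrightarrow>
     group G \<and> topspace X = carrier G \<and>
     continuous_map (prod_topology X X) X (\<lambda>(g, h). g \<otimes>\<^bsub>G\<^esub> h) \<and>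
     continuous_map X X (\<lambda>g. inv\<^bsub>G\<^esub> g) \<and>
     Hausdorff_space X \<and> locally_compact_space X \<and> second_countable X"

text \<open>Left Haar measure; only its null sets are used below, and these are also the null sets of
  the right Haar measures. Regularity is automatic on a locally compact second countable group.\<close>

definition haar_measure :: "('g, 'm) monoid_scheme \<Rightarrow> 'g topology \<Rightarrow> 'g measure \<Rightarrow> bool" where
  "haar_measure G X H \<longleftrightarrow>
     sets H = sets (borel_of X) \<and>
     (\<forall>g\<in>carrier G. distr H H (\<lambda>x. g \<otimes>\<^bsub>G\<^esub> x) = H) \<and>
     (\<forall>K. compactin X K \<and> K \<in> sets H \<longrightarrow> emeasure H K < \<infinity>) \<and>
     emeasure H (space H) \<noteq> 0"

definition mutually_singular :: "'a measure \<Rightarrow> 'a measure \<Rightarrow> bool" where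
  "mutually_singular M N \<longleftrightarrow>
     sets M = sets N \<and> (\<exists>A\<in>sets M. emeasure M A = 0 \<and> emeasure N (space N - A) = 0)"

definition measure_support :: "'a topology \<Rightarrow> 'a measure \<Rightarrow> 'a set" where
  "measure_support X M = {x \<in> topspace X. \<forall>U. openin X U \<and> x \<in> U \<longrightarrow> 0 < emeasure M U}"

definition symmetric_measure :: "('g, 'm) monoid_scheme \<Rightarrow> 'g measure \<Rightarrow> bool" where
  "symmetric_measure G \<mu> \<longleftrightarrow> distr \<mu> \<mu> (\<lambda>g. inv\<^bsub>G\<^esub> g) = \<mu>"


subsection \<open>\<open>G\<close>-spaces\<close>

definition standard_borel :: "'a measure \<Rightarrow> bool" where
  "standard_borel M \<longleftrightarrow>
     (\<exists>X. completely_metrizable_space X \<and> second_countable X \<and>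
          space M = topspace X \<and> sets M = sets (borel_of X))"

definition G_space ::
  "('g, 'm) monoid_scheme \<Rightarrow> 'g topology \<Rightarrow> 'a measure \<Rightarrow> ('g \<Rightarrow> 'a \<Rightarrow> 'a) \<Rightarrow> bool" where
  "G_space G X M act \<longleftrightarrow>
     lcsc_group G X \<and> standard_borel M \<and> prob_space M \<and>
     group_action G (space M) act \<and>
     (\<lambda>(g, x). act g x) \<in> borel_of X \<Otimes>\<^sub>M M \<rightarrow>\<^sub>M M \<and>
     (\<forall>g\<in>carrier G. null_sets (distr M M (act g)) = null_sets M)"

definition G_map ::
  "('g, 'm) monoid_scheme \<Rightarrow> 'a measure \<Rightarrow> ('g \<Rightarrow> 'a \<Rightarrow> 'a) \<Rightarrow>
   'b measure \<Rightarrow> ('g \<Rightarrow> 'b \<Rightarrow> 'b) \<Rightarrow> ('a \<Rightarrow> 'b) \<Rightarrow> bool" where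
  "G_map G M actM N actN \<pi> \<longleftrightarrow>
     \<pi> \<in> M \<rightarrow>\<^sub>M N \<and> distr M N \<pi> = N \<and>
     (\<forall>g\<in>carrier G. AE x in M. \<pi> (actM g x) = actN g (\<pi> x))"

definition is_quotient ::
  "('g, 'm) monoid_scheme \<Rightarrow> 'g topology \<Rightarrow> 'b measure \<Rightarrow> ('g \<Rightarrow> 'b \<Rightarrow> 'b) \<Rightarrow>
   'a measure \<Rightarrow> ('g \<Rightarrow> 'a \<Rightarrow> 'a) \<Rightarrow> bool" where
  "is_quotient G X N actN M actM \<longleftrightarrow>
     G_space G X M actM \<and> G_space G X N actN \<and> (\<exists>\<pi>. G_map G M actM N actN \<pi>)"

definition contractive ::
  "('g, 'm) monoid_scheme \<Rightarrow> 'g topology \<Rightarrow> 'a measure \<Rightarrow> ('g \<Rightarrow> 'a \<Rightarrow> 'a) \<Rightarrow> bool" where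
  "contractive G X M act \<longleftrightarrow>
     G_space G X M act \<and>
     (\<forall>B\<in>sets M. 0 < emeasure M B \<longrightarrow> (SUP g\<in>carrier G. emeasure M (act g ` B)) = 1)"


subsection \<open>The Poisson boundary\<close>

text \<open>Sequences are indexed from \<open>0\<close>, so \<open>\<omega>\<^sub>1\<close> is \<open>\<omega> 0\<close>.\<close>

definition walk_space :: "'g measure \<Rightarrow> (nat \<Rightarrow> 'g) measure" where
  "walk_space \<mu> = (\<Pi>\<^sub>M i\<in>(UNIV :: nat set). \<mu>)"

definition walk_act :: "('g, 'm) monoid_scheme \<Rightarrow> 'g \<Rightarrow> (nat \<Rightarrow> 'g) \<Rightarrow> (nat \<Rightarrow> 'g)" where
  "walk_act G g \<omega> = fun_upd \<omega> 0 (g \<otimes>\<^bsub>G\<^esub> \<omega> 0)"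

definition walk_T :: "('g, 'm) monoid_scheme \<Rightarrow> (nat \<Rightarrow> 'g) \<Rightarrow> (nat \<Rightarrow> 'g)" where
  "walk_T G \<omega> = (\<lambda>n. if n = 0 then \<omega> 0 \<otimes>\<^bsub>G\<^esub> \<omega> 1 else \<omega> (Suc n))"

text \<open>The measure \<open>\<mu>\<^sup>\<nat>\<close> is in general not quasi-invariant under \<open>T\<close> or under \<open>G\<close>. The null sets of
  \<open>walk_AE\<close> are the sets that are null for every \<open>G\<close>-translate of \<open>\<mu>\<^sup>\<nat>\<close>; they are preserved by
  both \<open>T\<close> and \<open>G\<close>. If \<open>\<mu>\<close> is in the class of Haar measure, \<open>walk_AE\<close> is the same as \<open>\<mu>\<^sup>\<nat>\<close>-almost
  everywhere.\<close>

definition walk_AE ::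
  "('g, 'm) monoid_scheme \<Rightarrow> 'g measure \<Rightarrow> ((nat \<Rightarrow> 'g) \<Rightarrow> bool) \<Rightarrow> bool" where
  "walk_AE G \<mu> Q \<longleftrightarrow> (\<forall>g\<in>carrier G. AE \<omega> in walk_space \<mu>. Q (walk_act G g \<omega>))"

text \<open>The space of \<open>T\<close>-ergodic components is the standard Borel space \<open>P\<close>, with a projection
  \<open>p\<close> from \<open>G\<^sup>\<nat>\<close>, whose measurable sets correspond under \<open>p\<close> exactly to the \<open>T\<close>-invariant
  measurable sets modulo null sets. It is unique up to isomorphism, so it is specified by a
  predicate: \<open>poisson_boundary G X \<mu> P act\<close> says that \<open>P\<close> with the action \<open>act\<close> is
  a realization of the Poisson boundary of \<open>(G, \<mu>)\<close>.\<close>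

definition ergodic_components ::
  "('g, 'm) monoid_scheme \<Rightarrow> 'g measure \<Rightarrow> 'p measure \<Rightarrow> ((nat \<Rightarrow> 'g) \<Rightarrow> 'p) \<Rightarrow> bool" where
  "ergodic_components G \<mu> P p \<longleftrightarrow>
     standard_borel P \<and>
     p \<in> walk_space \<mu> \<rightarrow>\<^sub>M P \<and> distr (walk_space \<mu>) P p = P \<and>
     walk_AE G \<mu> (\<lambda>\<omega>. p (walk_T G \<omega>) = p \<omega>) \<and>
     (\<forall>A\<in>sets (walk_space \<mu>).
        walk_AE G \<mu> (\<lambda>\<omega>. walk_T G \<omega> \<in> A \<longleftrightarrow> \<omega> \<in> A) \<longrightarrow>
        (\<exists>B\<in>sets P. walk_AE G \<mu> (\<lambda>\<omega>. \<omega> \<in> A \<longleftrightarrow> p \<omega> \<in> B)))"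

definition poisson_boundary ::
  "('g, 'm) monoid_scheme \<Rightarrow> 'g topology \<Rightarrow> 'g measure \<Rightarrow> 'p measure \<Rightarrow> ('g \<Rightarrow> 'p \<Rightarrow> 'p) \<Rightarrow> bool"
  where
  "poisson_boundary G X \<mu> P act \<longleftrightarrow>
     G_space G X P act \<and>
     (\<exists>p. ergodic_components G \<mu> P p \<and>
          (\<forall>g\<in>carrier G. walk_AE G \<mu> (\<lambda>\<omega>. p (walk_act G g \<omega>) = act g (p \<omega>))))"


subsection \<open>The \<open>ax+b\<close> group\<close>

text \<open>The pair \<open>(a, b)\<close> stands for the map \<open>x \<mapsto> a x + b\<close>, and multiplication is composition.\<close>

definition axb_group :: "(real \<times> real) monoid" where
  "axb_group =
     \<lparr>carrier = {(a, b). 0 < a},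
      mult = (\<lambda>(a, b) (c, d). (a * c, a * d + b)),
      one = (1, 0)\<rparr>"

definition axb_topology :: "(real \<times> real) topology" where
  "axb_topology = top_of_set (carrier axb_group)"

definition axb_act :: "real \<times> real \<Rightarrow> real \<Rightarrow> real" where
  "axb_act = (\<lambda>(a, b) x. a * x + b)"

lemma axb_act_mult: "axb_act (g \<otimes>\<^bsub>axb_group\<^esub> h) = axb_act g \<circ> axb_act h"
  by (cases g; cases h) (auto simp: axb_act_def axb_group_def algebra_simps)

lemma group_axb_group: "group axb_group"
proof (rule groupI)
  fix x assume "x \<in> carrier axb_group"
  then show "\<exists>y\<in>carrier axb_group. y \<otimes>\<^bsub>axb_group\<^esub> x = \<one>\<^bsub>axb_group\<^esub>"
    by (intro bexI[of _ "(1 / fst x, - snd x / fst x)"]) (auto simp: axb_group_def)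
qed (auto simp: axb_group_def algebra_simps)

lemma inv_axb_group:
  assumes "g \<in> carrier axb_group"
  shows "inv\<^bsub>axb_group\<^esub> g = (1 / fst g, - snd g / fst g)"
  using assms by (intro group.inv_equality[OF group_axb_group]) (auto simp: axb_group_def)

lemma lcsc_group_axb_group: "lcsc_group axb_group axb_topology"
proof -
  let ?C = "carrier axb_group"
  have C: "?C = {0<..} \<times> UNIV"
    by (auto simp: axb_group_def)
  have "open ?C"
    unfolding C by (intro open_Times) auto
  then have "locally_compact_space axb_topology"
    unfolding axb_topology_def
    by (intro locally_compact_space_open_subset)
       (auto simp: locally_compact_space_euclidean regular_space_euclidean)
  moreover have "second_countable axb_topology"
  proof -
    obtain B :: "(real \<times> real) set set" where "countable B" "topological_basis B"
      using ex_countable_basis by blast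
    then have "second_countable (euclidean :: (real \<times> real) topology)"
      unfolding second_countable_def
      by (metis open_openin topological_basisE topological_basis_open)
    then show ?thesis
      unfolding axb_topology_def by (rule second_countable_subtopology)
  qed
  moreover have "Hausdorff_space axb_topology"
    unfolding axb_topology_def by (simp add: Hausdorff_space_subtopology)
  moreover have "continuous_map (prod_topology axb_topology axb_topology) axb_topology
      (\<lambda>(g, h). g \<otimes>\<^bsub>axb_group\<^esub> h)"
  proof -
    have "continuous_on (?C \<times> ?C)
        (\<lambda>p. (fst (fst p) * fst (snd p), fst (fst p) * snd (snd p) + snd (fst p)))"
      by (intro continuous_intros)
    then show ?thesis
      unfolding axb_topology_def subtopology_Times[symmetric]
      by (auto simp: continuous_map_in_subtopology axb_group_def case_prod_unfold)
  qed
  moreover have "continuous_map axb_topology axb_topology (\<lambda>g. inv\<^bsub>axb_group\<^esub> g)"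
  proof -
    have "continuous_on ?C (\<lambda>g. (1 / fst g, - snd g / fst g))"
      by (intro continuous_intros) (auto simp: axb_group_def)
    then have "continuous_on ?C (\<lambda>g. inv\<^bsub>axb_group\<^esub> g)"
      by (rule continuous_on_eq) (simp add: inv_axb_group)
    then show ?thesis
      unfolding axb_topology_def
      by (auto simp: continuous_map_in_subtopology group.inv_closed[OF group_axb_group])
  qed
  ultimately show ?thesis
    by (simp add: lcsc_group_def group_axb_group axb_topology_def)
qed

end

theory Submission
  imports Defs
begin

text \<open>
  Contractivity: a set of positive Lebesgue measure nearly fills some interval, and an affine map
  blows this interval up to one that carries almost all of the mass of \<open>\<lambda>\<close>.

  Not a quotient: a quotient map composed with the projection of the path space to the Poisson
  boundary is a function \<open>\<phi>\<close> on the path space with law \<open>\<lambda>\<close> such that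
  \<open>\<phi>(\<omega>\<^sub>1, \<omega>\<^sub>2, \<dots>) = \<omega>\<^sub>1 \<cdots> \<omega>\<^sub>n \<phi>(\<omega>\<^sub>n\<^sub>+\<^sub>1, \<dots>)\<close> almost everywhere. For large \<open>n\<close> the value of \<open>\<phi>\<close> is nearly
  determined by the first \<open>n\<close> steps, although \<open>\<phi>(\<omega>\<^sub>n\<^sub>+\<^sub>1, \<dots>)\<close> is independent of them and has the
  nonatomic law \<open>\<lambda>\<close>. So the affine map \<open>\<omega>\<^sub>1 \<cdots> \<omega>\<^sub>n\<close> must contract, that is, the probability that
  its slope is at least \<open>1\<close> tends to \<open>0\<close>. By the symmetry of \<open>\<mu>\<close> the slope and its inverse have the
  same law, so this probability is at least \<open>1/2\<close>.
\<close>

subsection \<open>Absolute continuity and nearly filled intervals\<close>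

text \<open>If no \<open>d\<close> works, there are sets of \<open>N\<close>-measure below
  \<open>(1/2)^n\<close> whose \<open>M\<close>-measure stays at least \<open>e\<close>. By
  Borel-Cantelli their limsup is null for \<open>N\<close>, hence for \<open>M\<close>, but
  continuity from above gives it \<open>M\<close>-measure at least \<open>e\<close>. Smallness is
  phrased with \<open>emeasure\<close> because \<open>N\<close> may be infinite, as
  \<open>lborel\<close> is, and \<open>measure\<close> would be 0 on sets of infinite
  measure.\<close>

lemma uniform_absolute_continuity:
  assumes "finite_measure M" and sets: "sets M = sets N"
    and ac: "absolutely_continuous N M" and e: "0 < (e::real)"
  obtains (bound) d :: real where "0 < d"
    "\<And>A. A \<in> sets N \<Longrightarrow> emeasure N A < ennreal d \<Longrightarrow> measure M A < e"
proof (rule ccontr)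
  interpret finite_measure M by fact
  assume "\<not> thesis"
  have "\<exists>A\<in>sets N. emeasure N A < ennreal d \<and> e \<le> measure M A" if "0 < d" for d :: real
  proof (rule ccontr)
    assume "\<not> ?thesis"
    then have "measure M A < e" if "A \<in> sets N" "emeasure N A < ennreal d" for A
      using that by (meson leI)
    with \<open>0 < d\<close> \<open>\<not> thesis\<close> show False
      using bound by blast
  qed
  then have "\<exists>A\<in>sets N. emeasure N A < ennreal ((1/2)^n) \<and> e \<le> measure M A" for n :: nat
    by simp
  then obtain A where A: "\<And>n. A n \<in> sets N" "\<And>n. emeasure N (A n) < ennreal ((1/2)^n)"
    "\<And>n. e \<le> measure M (A n)"
    by metis
  have le: "measure N (A n) \<le> (1/2)^n" for n
    using A(2)[of n] by (simp add: measure_def enn2real_leI less_imp_le)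
  have "limsup A \<in> null_sets N"
  proof (rule borel_cantelli_limsup1)
    show "emeasure N (A n) < \<infinity>" for n
      using A(2)[of n] by (metis ennreal_less_top infinity_ennreal_def less_trans)
    show "summable (\<lambda>n. measure N (A n))"
      by (rule summable_comparison_test[OF _ summable_geometric[of "1/2::real"]]) (use le in auto)
  qed (use A in auto)
  then have null: "limsup A \<in> null_sets M"
    using ac by (auto simp: absolutely_continuous_def)
  have [measurable]: "A n \<in> sets M" for n
    using A(1) sets by simp
  define U where "U n = (\<Union>m\<in>{n..}. A m)" for n
  have U [measurable]: "U n \<in> sets M" for n
    unfolding U_def by measurable
  have "(\<lambda>n. measure M (U n)) \<longlonglongrightarrow> measure M (\<Inter>n. U n)"
    by (rule finite_Lim_measure_decseq) (auto simp: decseq_def U_def, force)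
  moreover have "(\<Inter>n. U n) = limsup A"
    by (simp add: limsup_INF_SUP U_def)
  moreover have "measure M (limsup A) = 0"
    using null by (simp add: measure_eq_0_null_sets)
  moreover have "e \<le> measure M (U n)" for n
    using A(3)[of n] finite_measure_mono[of "A n" "U n"] by (force simp: U_def)
  ultimately have "e \<le> 0"
    by (metis LIMSEQ_le_const)
  with e show False by simp
qed

text \<open>A weak form of the Lebesgue density theorem, by a covering argument. If \<open>B\<close>
  missed more than the proportion \<open>e\<close> of every interval, then nonoverlapping intervals
  covering a bounded part \<open>C\<close> of \<open>B\<close> inside a tight open set
  \<open>U\<close> would leave too much room in \<open>U - C\<close>.\<close>

lemma interval_mostly_filled:
  fixes B :: "real set"
  assumes B [measurable]: "B \<in> sets borel" and pos: "0 < emeasure lborel B" and e: "0 < (e::real)"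
  obtains (interval) a b where "a < b" "emeasure lborel ({a..b} - B) \<le> ennreal (e * (b - a))"
proof (rule ccontr)
  assume contra: "\<not> thesis"
  \<comment> \<open>\<open>covering_lemma\<close> works inside a box, and boundedness also makes the
    measure finite.\<close>
  obtain k :: nat where k: "0 < emeasure lborel (B \<inter> {-real k..real k})"
  proof (rule ccontr)
    assume "\<not> thesis"
    with that have "emeasure lborel (B \<inter> {-real k..real k}) = 0" for k
      by (metis not_gr_zero)
    then have "B \<inter> {-real k..real k} \<in> null_sets lborel" for k
      by (intro null_setsI) auto
    then have "(\<Union>k. B \<inter> {-real k..real k}) \<in> null_sets lborel"
      by (intro null_sets_UN) auto
    moreover have "(\<Union>k. B \<inter> {-real k..real k}) = B"
    proof -
      have "\<exists>k. -real k \<le> x \<and> x \<le> real k" for x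
        using real_arch_simple[of "\<bar>x\<bar>"] by (auto simp: abs_le_iff) (metis minus_le_iff)
      then show ?thesis by auto
    qed
    ultimately show False
      using pos by auto
  qed
  define C where "C = B \<inter> {-real k..real k}"
  have [measurable]: "C \<in> sets borel" by (simp add: C_def)
  have fin: "emeasure lborel C < \<infinity>"
    using emeasure_mono[of C "{-real k..real k}" lborel] by (auto simp: C_def top.not_eq_extremum le_less_trans)
  define m where "m = measure lborel C"
  have m: "emeasure lborel C = ennreal m" "0 < m"
  proof -
    show *: "emeasure lborel C = ennreal m"
      unfolding m_def by (intro emeasure_eq_ennreal_measure) (use fin in simp)
    show "0 < m"
      using k unfolding C_def[symmetric] * by simp
  qed
  obtain U where U: "open U" "C \<subseteq> U" "emeasure lborel (U - C) < ennreal (e * m)"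
    using outer_regular_lborel[of C "e * m"] e m by auto
  have [measurable]: "U \<in> sets borel" using U by auto
  \<comment> \<open>This gauge forces every cell of the cover into \<open>U\<close>, since each cell
    is tagged by a point of \<open>C\<close>.\<close>
  have "gauge (\<lambda>x. if x \<in> U then U else UNIV)"
    using U(1) by (auto simp: gauge_def)
  then obtain D where D: "countable D" "\<And>K. K \<in> D \<Longrightarrow> interior K \<noteq> {} \<and> (\<exists>c d. K = cbox c d)"
    "pairwise (\<lambda>A B. interior A \<inter> interior B = {}) D"
    "\<And>K. K \<in> D \<Longrightarrow> \<exists>x \<in> C \<inter> K. K \<subseteq> (if x \<in> U then U else UNIV)" "C \<subseteq> \<Union>D"
    using covering_lemma[of C "-real k - 1" "real k + 1" "\<lambda>x. if x \<in> U then U else UNIV"]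
    by (force simp: C_def)
  have DU: "K \<subseteq> U" if "K \<in> D" for K
    using D(4)[OF that] U(2) by (auto split: if_splits)
  have DB: "K \<in> sets borel" if "K \<in> D" for K
    using D(2)[OF that] by auto
  \<comment> \<open>Cells may share endpoints, so the densities are summed over the disjoint
    interiors; the endpoints form a countable union of null sets.\<close>
  have dens: "ennreal e * emeasure lborel (interior K) \<le> emeasure lborel (interior K - C)" if K: "K \<in> D" for K
  proof -
    obtain c d where cd: "K = {c..d}" "c < d"
      using D(2)[OF K] by (auto simp: interior_cbox)
    have "emeasure lborel ({c..d} - B) \<le> emeasure lborel ({c<..<d} - C \<union> {c, d})"
      by (intro emeasure_mono) (auto simp: C_def)
    also have "\<dots> \<le> emeasure lborel ({c<..<d} - C) + emeasure lborel {c, d}"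
      by (intro emeasure_subadditive) auto
    also have "emeasure lborel {c, d} = 0"
      by (intro emeasure_lborel_countable) auto
    finally have "emeasure lborel ({c..d} - B) \<le> emeasure lborel ({c<..<d} - C)"
      by simp
    moreover have "ennreal (e * (d - c)) \<le> emeasure lborel ({c..d} - B)"
      using contra interval[of c d] cd(2) by (meson linear)
    ultimately show ?thesis
      using cd e by (simp add: ennreal_mult interior_atLeastAtMost_real)
  qed
  have "C \<subseteq> (\<Union>K\<in>D. interior K) \<union> (\<Union>K\<in>D. K - interior K)"
    using D(5) by blast
  moreover have N: "(\<Union>K\<in>D. K - interior K) \<in> null_sets lborel"
  proof (rule null_sets_UN'[OF D(1)])
    fix K assume "K \<in> D"
    then obtain c d where "K = {c..d}"
      using D(2) by force
    then have "K - interior K \<subseteq> {c, d}"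
      by (auto simp: interior_atLeastAtMost_real)
    then have "countable (K - interior K)"
      by (meson countable_finite finite.emptyI finite_insert finite_subset)
    then show "K - interior K \<in> null_sets lborel"
      by (rule countable_imp_null_set_lborel)
  qed
  moreover have [measurable]: "(\<Union>K\<in>D. interior K) \<in> sets borel"
    by (intro borel_open open_UN) simp
  ultimately have "emeasure lborel C \<le> emeasure lborel ((\<Union>K\<in>D. interior K) \<union> (\<Union>K\<in>D. K - interior K))"
    using null_setsD2[OF N] by (intro emeasure_mono sets.Un) simp_all
  also have "\<dots> = emeasure lborel (\<Union>K\<in>D. interior K)"
    using N by (intro emeasure_Un_null_set) auto
  finally have "ennreal (e * m) \<le> ennreal e * emeasure lborel (\<Union>K\<in>D. interior K)"
    using e m by (simp add: ennreal_mult mult_left_mono)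
  also have "emeasure lborel (\<Union>K\<in>D. interior K) = (\<integral>\<^sup>+K. emeasure lborel (interior K) \<partial>count_space D)"
    using D(1,3) by (intro emeasure_UN_countable) (auto simp: disjoint_family_on_def pairwise_def)
  also have "ennreal e * \<dots> = (\<integral>\<^sup>+K. ennreal e * emeasure lborel (interior K) \<partial>count_space D)"
    by (rule nn_integral_cmult[symmetric]) simp
  also have "\<dots> \<le> (\<integral>\<^sup>+K. emeasure lborel (interior K - C) \<partial>count_space D)"
    by (intro nn_integral_mono) (simp add: dens)
  also have "\<dots> = emeasure lborel (\<Union>K\<in>D. interior K - C)"
    using D(1,3) by (intro emeasure_UN_countable[symmetric]) (auto simp: disjoint_family_on_def pairwise_def)
  also have "\<dots> \<le> emeasure lborel (U - C)"
    using DU interior_subset by (intro emeasure_mono) (blast, simp)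
  finally show False
    using U(3) by simp
qed

subsection \<open>The action of the \<open>ax+b\<close> group on the line\<close>

lemma sets_borel_of_axb_topology:
  "sets (borel_of axb_topology) = sets (restrict_space borel (carrier axb_group))"
proof -
  have "carrier axb_group = {0<..} \<times> UNIV"
    by (auto simp: axb_group_def)
  then have "open (carrier axb_group)"
    by (simp add: open_Times)
  then have "sets (restrict_space borel (carrier axb_group)) =
      sigma_sets (carrier axb_group) ((\<inter>) (carrier axb_group) ` {S. open S})"
    by (simp add: sets_restrict_space borel_def sigma_sets_Int sigma_sets.Basic)
  moreover have "{U. openin axb_topology U} = (\<inter>) (carrier axb_group) ` {S. open S}"
    by (auto simp: axb_topology_def openin_open)
  moreover have "{U. openin axb_topology U} \<subseteq> Pow (carrier axb_group)"
    by (auto simp: axb_topology_def openin_open)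
  ultimately show ?thesis
    by (simp add: borel_of_def axb_topology_def sets_measure_of)
qed

lemma space_borel_of_axb_topology: "space (borel_of axb_topology) = carrier axb_group"
  using sets_eq_imp_space_eq[OF sets_borel_of_axb_topology] by (simp add: space_restrict_space)

lemma fst_snd_measurable_axb:
  assumes "sets M = sets (borel_of axb_topology)"
  shows "fst \<in> borel_measurable M" "snd \<in> borel_measurable M"
proof -
  have *: "M \<rightarrow>\<^sub>M borel = restrict_space borel (carrier axb_group) \<rightarrow>\<^sub>M borel"
    using assms sets_borel_of_axb_topology by (intro measurable_cong_sets) auto
  show "fst \<in> borel_measurable M" "snd \<in> borel_measurable M"
    unfolding * borel_prod[symmetric] by (intro measurable_restrict_space1, simp)+
qed

text \<open>Contractivity speaks of images. Writing the image as a preimage under the inverse map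
  gives measurability; the factor comes from the affine change of variables.\<close>

lemma emeasure_lborel_axb_act:
  assumes [measurable]: "B \<in> sets borel" and a: "0 < a"
  shows "axb_act (a, b) ` B \<in> sets borel"
    and "emeasure lborel (axb_act (a, b) ` B) = ennreal a * emeasure lborel B"
proof -
  have image: "axb_act (a, b) ` B = (\<lambda>x. (x - b) / a) -` B"
    using a by (force simp: axb_act_def image_iff field_simps)
  show *: "axb_act (a, b) ` B \<in> sets borel"
    unfolding image by (intro measurable_sets_borel[where M=borel] assms) measurable
  have "(\<lambda>x. b + a * x) -` axb_act (a, b) ` B = B"
    unfolding image using a by (auto simp: field_simps)
  then show "emeasure lborel (axb_act (a, b) ` B) = ennreal a * emeasure lborel B"
    using a * by (subst lborel_real_affine[of a b])
      (simp_all add: emeasure_density nn_integral_cmult_indicator emeasure_distr)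
qed

lemma group_action_axb_act: "group_action axb_group UNIV axb_act"
proof -
  interpret group axb_group by (rule group_axb_group)
  have "bij (axb_act g)" if "g \<in> carrier axb_group" for g
  proof (rule o_bij)
    have "axb_act \<one>\<^bsub>axb_group\<^esub> = id"
      by (auto simp: axb_act_def axb_group_def)
    then show "axb_act (inv\<^bsub>axb_group\<^esub> g) \<circ> axb_act g = id" "axb_act g \<circ> axb_act (inv\<^bsub>axb_group\<^esub> g) = id"
      using that by (simp_all flip: axb_act_mult)
  qed
  then have "axb_act \<in> hom axb_group (BijGroup UNIV)"
    by (auto simp: hom_def BijGroup_def Bij_def axb_act_mult compose_def o_def)
  then show ?thesis
    unfolding group_action_def by (intro group_hom.intro group_hom_axioms.intro group_BijGroup) auto
qed

lemma G_space_axb_act: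
  assumes "prob_space lam" and sets [measurable_cong]: "sets lam = sets borel"
    and null: "null_sets lam = null_sets lborel"
  shows "G_space axb_group axb_topology lam axb_act"
proof -
  have space: "space lam = UNIV"
    using sets_eq_imp_space_eq[OF sets] by simp
  have "standard_borel lam"
    unfolding standard_borel_def
  proof (intro exI conjI)
    show "completely_metrizable_space (euclidean :: real topology)"
      by (rule completely_metrizable_space_euclidean)
    show "second_countable (euclidean :: real topology)"
      using ex_countable_basis unfolding second_countable_def
      by (metis open_openin topological_basisE topological_basis_open)
    show "sets lam = sets (borel_of euclidean)"
      using sets by (simp add: borel_of_def borel_def)
  qed (simp add: space)
  moreover have "(\<lambda>(g, x). axb_act g x) \<in> borel_of axb_topology \<Otimes>\<^sub>M lam \<rightarrow>\<^sub>M lam"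
  proof -
    note [measurable] = fst_snd_measurable_axb[OF refl]
    have "(\<lambda>(g, x). fst g * x + snd g) \<in> borel_of axb_topology \<Otimes>\<^sub>M lam \<rightarrow>\<^sub>M lam"
      by measurable
    then show ?thesis
      by (simp add: axb_act_def case_prod_unfold)
  qed
  \<comment> \<open>Null sets of \<open>lam\<close> are those of \<open>lborel\<close>, which an
    affine map only rescales by its slope.\<close>
  moreover have "null_sets (distr lam lam (axb_act g)) = null_sets lam" if g: "g \<in> carrier axb_group" for g
  proof -
    obtain a b where ab: "g = (a, b)" "0 < a"
      using g by (auto simp: axb_group_def)
    have [measurable]: "axb_act g \<in> lam \<rightarrow>\<^sub>M lam"
      unfolding ab axb_act_def by simp
    have "A \<in> null_sets (distr lam lam (axb_act g)) \<longleftrightarrow> A \<in> null_sets lam" for A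
    proof (cases "A \<in> sets borel")
      case True
      let ?B = "axb_act g -` A"
      have B: "?B \<in> sets borel"
        using measurable_sets[OF \<open>axb_act g \<in> lam \<rightarrow>\<^sub>M lam\<close>, of A] True sets space by simp
      have "axb_act g ` ?B = A"
        using ab by (force simp: axb_act_def image_iff intro!: exI[of _ "(_ - b) / a"])
      then have "emeasure lborel A = ennreal a * emeasure lborel ?B"
        using emeasure_lborel_axb_act(2)[OF B ab(2), of b] ab(1) by simp
      then have "A \<in> null_sets lborel \<longleftrightarrow> ?B \<in> null_sets lborel"
        using True B ab by (auto simp: null_sets_def)
      moreover have "A \<in> null_sets (distr lam lam (axb_act g)) \<longleftrightarrow> ?B \<in> null_sets lam"
        using True sets space
        by (subst null_sets_distr_iff[OF \<open>axb_act g \<in> lam \<rightarrow>\<^sub>M lam\<close>]) simp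
      ultimately show ?thesis
        using null by simp
    qed (simp add: null_sets_def sets)
    then show ?thesis by blast
  qed
  ultimately show ?thesis
    using assms(1) by (simp add: G_space_def lcsc_group_axb_group group_action_axb_act space)
qed

section \<open>Contractivity of the affine action\<close>

lemma contractive_axb_act:
  assumes "prob_space lam" and sets: "sets lam = sets borel"
    and null: "null_sets lam = null_sets lborel"
  shows "contractive axb_group axb_topology lam axb_act"
  unfolding contractive_def
proof (intro conjI ballI impI antisym)
  interpret prob_space lam by fact
  note [measurable_cong] = sets
  have space: "space lam = UNIV"
    using sets_eq_imp_space_eq[OF sets] by simp
  show "G_space axb_group axb_topology lam axb_act"
    by (rule G_space_axb_act) fact+
  fix B assume "B \<in> sets lam" and pos: "0 < emeasure lam B"
  then have [measurable]: "B \<in> sets borel"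
    using sets by simp
  show "(SUP g\<in>carrier axb_group. emeasure lam (axb_act g ` B)) \<le> 1"
    by (intro SUP_least emeasure_le_1)
  have Bpos: "0 < emeasure lborel B"
  proof -
    have "B \<notin> null_sets lborel"
      unfolding null[symmetric] using pos by (simp add: null_sets_def)
    then show ?thesis
      by (simp add: null_sets_def zero_less_iff_neq_zero)
  qed
  have "\<exists>g\<in>carrier axb_group. 1 - \<epsilon> \<le> measure lam (axb_act g ` B)" if eps: "0 < \<epsilon>" for \<epsilon>
  proof -
    obtain d where d: "0 < d"
      "\<And>A. A \<in> sets lborel \<Longrightarrow> emeasure lborel A < ennreal d \<Longrightarrow> measure lam A < \<epsilon> / 2"
    proof (rule uniform_absolute_continuity[of lam lborel "\<epsilon> / 2"])
      show "absolutely_continuous lborel lam"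
        unfolding absolutely_continuous_def null by simp
    qed (use eps sets in \<open>simp_all add: finite_measure_axioms\<close>)
    have "(\<lambda>n. measure lam {- real n..real n}) \<longlonglongrightarrow> measure lam (\<Union>n. {- real n..real n})"
      by (rule finite_Lim_measure_incseq) (auto simp: incseq_def)
    moreover have "(\<Union>n. {- real n..real n}) = space lam"
    proof -
      have "\<exists>n. \<bar>x\<bar> \<le> real n" for x by (rule real_arch_simple)
      then show ?thesis by (auto simp: space abs_le_iff) (metis minus_le_iff)
    qed
    ultimately have "(\<lambda>n. measure lam {- real n..real n}) \<longlonglongrightarrow> 1"
      by (simp add: prob_space)
    then have "eventually (\<lambda>n. 1 - \<epsilon> / 2 < measure lam {- real n..real n} \<and> 0 < n) sequentially"
      using that by (intro eventually_conj order_tendstoD(1) eventually_gt_at_top) auto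
    then obtain R where R: "1 - \<epsilon> / 2 < measure lam {- real R..real R}" "0 < R"
      using eventually_happens by force
    \<comment> \<open>The interval will be stretched to length \<open>2 * R\<close>, so with this
      tolerance the missed part has Lebesgue measure at most
      \<open>2 * R * (d / (4 * R)) = d / 2\<close>.\<close>
    obtain u v where uv: "u < v" "emeasure lborel ({u..v} - B) \<le> ennreal (d / (4 * R) * (v - u))"
      using interval_mostly_filled[of B "d / (4 * R)"] Bpos d R by auto
    \<comment> \<open>\<open>a\<close> and \<open>b\<close> are chosen so that \<open>u\<close> goes
      to \<open>- R\<close> and \<open>v\<close> to \<open>R\<close>.\<close>
    define a where "a = 2 * R / (v - u)"
    define b where "b = - R - a * u"
    have a: "0 < a" using uv R by (simp add: a_def)
    let ?g = "axb_act (a, b)"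
    have uv': "a * (v - u) = 2 * R" using uv by (simp add: a_def)
    have inj: "inj ?g" using a by (auto simp: axb_act_def inj_def)
    have "?g ` {u..v} = {-real R..real R}"
    proof -
      have "a * u + b = - R" "a * v + b = R"
        using uv' by (simp_all add: b_def algebra_simps)
      then show ?thesis
        using a uv by (simp add: axb_act_def image_affinity_atLeastAtMost)
    qed
    then have image: "{-real R..real R} - ?g ` B = ?g ` ({u..v} - B)"
      by (simp add: image_set_diff[OF inj])
    have [measurable]: "?g ` B \<in> sets borel"
      using a by (intro emeasure_lborel_axb_act(1)) auto
    have "emeasure lborel ({-real R..real R} - ?g ` B) = ennreal a * emeasure lborel ({u..v} - B)"
      unfolding image using a by (intro emeasure_lborel_axb_act(2)) auto
    also have "\<dots> \<le> ennreal a * ennreal (d / (4 * R) * (v - u))"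
      using uv by (intro mult_left_mono) auto
    also have "\<dots> = ennreal (d / 2)"
    proof -
      have "a * (d / (4 * R) * (v - u)) = (a * (v - u)) * (d / (4 * R))"
        by simp
      also have "\<dots> = d / 2"
        using R unfolding uv' by simp
      finally show ?thesis
        using a d uv R by (simp add: ennreal_mult[symmetric])
    qed
    also have "\<dots> < ennreal d"
      using d by (simp add: ennreal_lessI)
    finally have "measure lam ({-real R..real R} - ?g ` B) < \<epsilon> / 2"
      by (intro d) auto
    moreover have "measure lam {-real R..real R} \<le> measure lam (({-real R..real R} - ?g ` B) \<union> ?g ` B)"
      by (intro finite_measure_mono) auto
    moreover have "\<dots> \<le> measure lam ({-real R..real R} - ?g ` B) + measure lam (?g ` B)"
      by (intro measure_Un_le) auto
    ultimately show ?thesis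
      using R a by (intro bexI[of _ "(a, b)"]) (auto simp: axb_group_def)
  qed
  note almost_full = this
  show "1 \<le> (SUP g\<in>carrier axb_group. emeasure lam (axb_act g ` B))"
  proof (rule ennreal_le_epsilon)
    fix e :: real assume "0 < e"
    then obtain g where g: "g \<in> carrier axb_group" "1 - e \<le> measure lam (axb_act g ` B)"
      using almost_full by blast
    then have "ennreal 1 \<le> ennreal (measure lam (axb_act g ` B) + e)"
      by (intro ennreal_leI) simp
    also have "\<dots> = emeasure lam (axb_act g ` B) + ennreal e"
      using \<open>0 < e\<close> by (simp add: emeasure_eq_measure)
    also have "\<dots> \<le> (SUP g\<in>carrier axb_group. emeasure lam (axb_act g ` B)) + ennreal e"
      using g(1) by (intro add_right_mono SUP_upper)
    finally show "1 \<le> (SUP g\<in>carrier axb_group. emeasure lam (axb_act g ` B)) + ennreal e"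
      by simp
  qed
qed

subsection \<open>Resampling the tail of an i.i.d. sequence\<close>

context sequence_space
begin

text \<open>Prepending an independent step to an i.i.d. sequence reproduces its law. Measurability
  of \<open>Q\<close> serves the passage from pairs back to sequences; the one-directional rules
  that follow pull back arbitrary almost sure properties.\<close>

lemma AE_case_nat_iff:
  assumes "Measurable.pred S Q"
  shows "(AE \<omega> in S. Q \<omega>) \<longleftrightarrow> (AE (s, \<omega>) in M \<Otimes>\<^sub>M S. Q (case_nat s \<omega>))"
  using assms by (subst PiM_iter[symmetric], subst AE_distr_iff) (auto simp: case_prod_unfold)

lemma AE_case_natD:
  assumes "AE \<omega> in S. Q \<omega>"
  shows "AE (s, \<omega>) in M \<Otimes>\<^sub>M S. Q (case_nat s \<omega>)"
proof -
  have "(\<lambda>(s, \<omega>). case_nat s \<omega>) \<in> M \<Otimes>\<^sub>M S \<rightarrow>\<^sub>M S"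
    by measurable
  from AE_distrD[OF this, of Q] show ?thesis
    unfolding PiM_iter using assms by (simp add: case_prod_unfold)
qed

lemma AE_comb_seqD:
  assumes "AE \<omega> in S. Q \<omega>"
  shows "AE (\<omega>, \<omega>') in S \<Otimes>\<^sub>M S. Q (comb_seq n \<omega> \<omega>')"
  using AE_distrD[OF measurable_comb_seq[of n M], of Q] assms unfolding PiM_comb_seq
  by (simp add: case_prod_unfold)

lemma measure_comb_seq_vimage:
  assumes "A \<in> sets S"
  shows "measure (S \<Otimes>\<^sub>M S) {x \<in> space (S \<Otimes>\<^sub>M S). case_prod (comb_seq n) x \<in> A} = measure S A"
proof -
  have "measure S A = measure (distr (S \<Otimes>\<^sub>M S) S (case_prod (comb_seq n))) A"
    using PiM_comb_seq[of n] by simp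
  also have "\<dots> = measure (S \<Otimes>\<^sub>M S) (case_prod (comb_seq n) -` A \<inter> space (S \<Otimes>\<^sub>M S))"
    using assms by (intro measure_distr measurable_comb_seq) auto
  finally show ?thesis
    by (simp add: vimage_def Int_def conj_commute)
qed

lemma measure_fst_vimage:
  assumes [measurable]: "A \<in> sets S"
  shows "measure (S \<Otimes>\<^sub>M S) {x \<in> space (S \<Otimes>\<^sub>M S). fst x \<in> A} = measure S A"
proof -
  have "{x \<in> space (S \<Otimes>\<^sub>M S). fst x \<in> A} = A \<times> space S"
    using sets.sets_into_space[OF assms] by (auto simp: space_pair_measure)
  then show ?thesis
    by (simp add: measure_def P.emeasure_pair_measure_Times P.emeasure_space_1)
qed

text \<open>This expresses, without conditional expectations, that \<open>A\<close> is nearly determined by the first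
  \<open>n\<close> steps: replacing the later steps by an independent copy rarely changes membership in \<open>A\<close>.\<close>

lemma comb_seq_converges_in_prob:
  assumes "A \<in> sets S"
  shows "(\<lambda>n. measure (S \<Otimes>\<^sub>M S)
      {x \<in> space (S \<Otimes>\<^sub>M S). (case_prod (comb_seq n) x \<in> A) \<noteq> (fst x \<in> A)}) \<longlonglongrightarrow> 0"
proof -
  interpret SS: pair_prob_space S S ..
  let ?d = "\<lambda>A n. {x \<in> space (S \<Otimes>\<^sub>M S). (case_prod (comb_seq n) x \<in> A) \<noteq> (fst x \<in> A)}"
  note [measurable] = measurable_comb_seq
  have S_eq: "sets S = sigma_sets (\<Pi>\<^sub>E i\<in>UNIV. space M)
      {{f \<in> \<Pi>\<^sub>E i\<in>UNIV. space M. f i \<in> A} |i A. i \<in> UNIV \<and> A \<in> sets M}"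
    by (rule sets_PiM_single)
  have A: "A \<in> sigma_sets (\<Pi>\<^sub>E i\<in>UNIV. space M)
      {{f \<in> \<Pi>\<^sub>E i\<in>UNIV. space M. f i \<in> A} |i A. i \<in> UNIV \<and> A \<in> sets M}"
    using assms unfolding S_eq .
  show ?thesis
    using A
  proof (induction rule: sigma_sets.induct)
    case (Basic a)
    then obtain i B where a: "a = {f \<in> \<Pi>\<^sub>E i\<in>UNIV. space M. f i \<in> B}" "B \<in> sets M"
      by auto
    \<comment> \<open>Resampling keeps the coordinates below \<open>n\<close>, so a condition on
      coordinate \<open>i\<close> is unaffected once \<open>n\<close> exceeds
      \<open>i\<close>.\<close>
    have "?d a n = {}" if "i < n" for n
    proof -
      have "case_prod (comb_seq n) x \<in> a \<longleftrightarrow> fst x \<in> a" if "x \<in> space (S \<Otimes>\<^sub>M S)" for x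
        using measurable_space[OF measurable_comb_seq that, of n] that \<open>i < n\<close>
        by (auto simp: a space_PiM space_pair_measure comb_seq_less)
      then show ?thesis by blast
    qed
    then have "eventually (\<lambda>n. measure (S \<Otimes>\<^sub>M S) (?d a n) = 0) sequentially"
      by (intro eventually_mono[OF eventually_gt_at_top[of i]]) (simp only: measure_empty)
    then show ?case
      by (rule tendsto_eventually)
  next
    case Empty
    then show ?case by simp
  next
    case (Compl a)
    have "?d ((\<Pi>\<^sub>E i\<in>UNIV. space M) - a) n = ?d a n" for n
      using measurable_space[OF measurable_comb_seq, of _ M n]
      by (auto simp: space_PiM space_pair_measure)
    with Compl.IH show ?case by simp
  next
    case (Union a)
    then have [measurable]: "a i \<in> sets S" for i
      unfolding S_eq by simp
    \<comment> \<open>The first \<open>N\<close> sets are handled by the induction hypothesis. The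
      original and the resampled sequence both have law \<open>S\<close>, so each falls into the
      remainder \<open>R N\<close> with the same small probability.\<close>
    define R where "R N = (\<Union>i. a i) - (\<Union>i<N. a i)" for N :: nat
    have [measurable]: "R N \<in> sets S" for N
      unfolding R_def by measurable
    have "(\<lambda>N. measure S (R N)) \<longlonglongrightarrow> measure S (\<Inter>N. R N)"
      by (rule P.finite_Lim_measure_decseq) (auto simp: R_def decseq_def)
    moreover have "(\<Inter>N. R N) = {}"
      by (auto simp: R_def)
    ultimately have R0: "(\<lambda>N. measure S (R N)) \<longlonglongrightarrow> 0"
      by simp
    show ?case
    proof (rule LIMSEQ_I)
      fix e :: real assume e: "0 < e"
      obtain N where N: "measure S (R N) < e / 4"
        using order_tendstoD(2)[OF R0, of "e / 4"] e by (auto simp: eventually_sequentially)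
      have "(\<lambda>n. \<Sum>i<N. measure (S \<Otimes>\<^sub>M S) (?d (a i) n)) \<longlonglongrightarrow> (\<Sum>i<N. 0)"
        by (intro tendsto_sum Union.IH)
      then obtain n0 where n0: "\<And>n. n0 \<le> n \<Longrightarrow> (\<Sum>i<N. measure (S \<Otimes>\<^sub>M S) (?d (a i) n)) < e / 2"
        using order_tendstoD(2)[of _ 0 sequentially "e / 2"] e by (auto simp: eventually_sequentially)
      have "measure (S \<Otimes>\<^sub>M S) (?d (\<Union>i. a i) n) < e" if "n0 \<le> n" for n
      proof -
        let ?R1 = "{x \<in> space (S \<Otimes>\<^sub>M S). case_prod (comb_seq n) x \<in> R N}"
        let ?R2 = "{x \<in> space (S \<Otimes>\<^sub>M S). fst x \<in> R N}"
        have "measure (S \<Otimes>\<^sub>M S) (?d (\<Union>i. a i) n)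
            \<le> measure (S \<Otimes>\<^sub>M S) ((\<Union>i<N. ?d (a i) n) \<union> (?R1 \<union> ?R2))"
        proof (rule SS.finite_measure_mono)
          have "\<exists>i<N. (u \<in> a i) \<noteq> (w \<in> a i)"
            if "(u \<in> (\<Union>i. a i)) \<noteq> (w \<in> (\<Union>i. a i))" "u \<notin> R N" "w \<notin> R N" for u w
            using that by (auto simp: R_def)
          then show "?d (\<Union>i. a i) n \<subseteq> (\<Union>i<N. ?d (a i) n) \<union> (?R1 \<union> ?R2)"
            by (intro subsetI) (simp, blast)
        qed measurable
        also have "\<dots> \<le> measure (S \<Otimes>\<^sub>M S) (\<Union>i<N. ?d (a i) n) + measure (S \<Otimes>\<^sub>M S) (?R1 \<union> ?R2)"
          by (intro measure_Un_le) measurable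
        also have "\<dots> \<le> (\<Sum>i<N. measure (S \<Otimes>\<^sub>M S) (?d (a i) n))
            + (measure (S \<Otimes>\<^sub>M S) ?R1 + measure (S \<Otimes>\<^sub>M S) ?R2)"
          by (intro add_mono measure_UNION_le measure_Un_le) measurable
        also have "\<dots> < e"
          using n0[OF that] N measure_comb_seq_vimage[of "R N" n] measure_fst_vimage[of "R N"] by simp
        finally show ?thesis .
      qed
      then show "\<exists>no. \<forall>n\<ge>no. norm (measure (S \<Otimes>\<^sub>M S) (?d (\<Union>i. a i) n) - 0) < e"
        by auto
    qed
  qed
qed

text \<open>The product measure is determined by finite cylinders, and the preimage of a cylinder is
  a cylinder whose sides have the same measures. It will be applied to the inversion of every step
  of a symmetric walk.\<close>

lemma distr_componentwise:
  assumes [measurable]: "f \<in> M \<rightarrow>\<^sub>M M" and f: "distr M M f = M"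
  shows "distr S S (\<lambda>\<omega> i. f (\<omega> i)) = S"
proof (rule PiM_eq)
  have componentwise: "(\<lambda>\<omega> i. f (\<omega> i)) \<in> S \<rightarrow>\<^sub>M S"
    using measurable_space[OF assms(1)]
    by (intro measurable_PiM_single') (auto simp: space_PiM PiE_iff)
  fix J :: "nat set" and F
  assume J: "finite J" "J \<subseteq> UNIV" "\<And>j. j \<in> J \<Longrightarrow> F j \<in> sets M"
  let ?X = "prod_emb UNIV (\<lambda>_. M) J (Pi\<^sub>E J F)"
  let ?Y = "prod_emb UNIV (\<lambda>_. M) J (\<Pi>\<^sub>E j\<in>J. f -` F j \<inter> space M)"
  have Y: "f -` F j \<inter> space M \<in> sets M" if "j \<in> J" for j
    using J(3)[OF that] by measurable
  have "(\<lambda>\<omega> i. f (\<omega> i)) -` ?X \<inter> space S = ?Y"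
    using measurable_space[OF assms(1)] by (auto simp: prod_emb_def space_PiM PiE_iff)
  then have "emeasure (distr S S (\<lambda>\<omega> i. f (\<omega> i))) ?X = emeasure S ?Y"
    using J by (subst emeasure_distr) (auto intro!: sets_PiM_I componentwise)
  also have "\<dots> = (\<Prod>j\<in>J. emeasure M (f -` F j \<inter> space M))"
    using J Y by (intro emeasure_PiM_emb) auto
  also have "\<dots> = (\<Prod>j\<in>J. emeasure M (F j))"
    using J(3) by (intro prod.cong refl, subst (2) f[symmetric]) (simp add: emeasure_distr)
  finally show "emeasure (distr S S (\<lambda>\<omega> i. f (\<omega> i))) ?X = (\<Prod>j\<in>J. emeasure M (F j))" .
qed simp

end

text \<open>The inner condition says that a section of the exceptional set has measure 0, and the
  measure of a section is a measurable function. This allows nested almost everywhere statements to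
  be merged again.\<close>

lemma (in sigma_finite_measure) pred_AE_pair:
  assumes [measurable]: "Measurable.pred (N \<Otimes>\<^sub>M M) (\<lambda>(x, y). Q x y)"
  shows "Measurable.pred N (\<lambda>x. AE y in M. Q x y)"
proof -
  define D where "D = {z \<in> space (N \<Otimes>\<^sub>M M). \<not> (case z of (x, y) \<Rightarrow> Q x y)}"
  have D [measurable]: "D \<in> sets (N \<Otimes>\<^sub>M M)"
    unfolding D_def by measurable
  have "(AE y in M. Q x y) \<longleftrightarrow> emeasure M (Pair x -` D) = 0" if "x \<in> space N" for x
    using that by (intro AE_iff_measurable sets_Pair1[OF D]) (auto simp: D_def space_pair_measure)
  moreover have "(\<lambda>x. emeasure M (Pair x -` D)) \<in> borel_measurable N"
    by (rule measurable_emeasure_Pair[OF D])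
  then have "Measurable.pred N (\<lambda>x. emeasure M (Pair x -` D) = 0)"
    by measurable
  ultimately show ?thesis
    by (simp cong: measurable_cong)
qed

subsection \<open>Random affine maps\<close>

text \<open>With \<open>intercept\<close>, these are the coordinates of the product of the first
  \<open>n\<close> steps: the composite map is
  \<open>x \<mapsto> slope n \<omega> * x + intercept n \<omega>\<close>.\<close>

definition slope :: "nat \<Rightarrow> (nat \<Rightarrow> real \<times> real) \<Rightarrow> real" where
  "slope n \<omega> = (\<Prod>i<n. fst (\<omega> i))"

definition intercept :: "nat \<Rightarrow> (nat \<Rightarrow> real \<times> real) \<Rightarrow> real" where
  "intercept n \<omega> = (\<Sum>i<n. slope i \<omega> * snd (\<omega> i))"

lemma slope_case_nat: "slope (Suc n) (case_nat s \<omega>) = fst s * slope n \<omega>"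
  by (simp add: slope_def prod.lessThan_Suc_shift del: prod.lessThan_Suc)

lemma intercept_case_nat: "intercept (Suc n) (case_nat s \<omega>) = fst s * intercept n \<omega> + snd s"
  by (simp add: intercept_def sum.lessThan_Suc_shift slope_case_nat sum_distrib_left mult.assoc
        del: sum.lessThan_Suc)
    (simp add: slope_def)

locale affine_walk = sequence_space M for M :: "(real \<times> real) measure" +
  fixes \<phi> :: "(nat \<Rightarrow> real \<times> real) \<Rightarrow> real"
  assumes fst_measurable [measurable]: "fst \<in> borel_measurable M"
    and snd_measurable [measurable]: "snd \<in> borel_measurable M"
    and \<phi>_measurable [measurable]: "\<phi> \<in> borel_measurable S"
    and \<phi>_case_nat: "AE (s, \<omega>) in M \<Otimes>\<^sub>M S. \<phi> (case_nat s \<omega>) = fst s * \<phi> \<omega> + snd s"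
begin

lemma slope_measurable [measurable]: "slope n \<in> borel_measurable S"
  unfolding slope_def by measurable

lemma intercept_measurable [measurable]: "intercept n \<in> borel_measurable S"
  unfolding intercept_def by measurable

text \<open>Iterates the one-step equivariance, peeling off the first step. The quantifiers are
  nested because the identity is later used with the first steps fixed and only the tail
  random.\<close>

lemma \<phi>_comb_seq:
  "AE \<omega> in S. AE \<omega>' in S. \<phi> (comb_seq n \<omega> \<omega>') = slope n \<omega> * \<phi> \<omega>' + intercept n \<omega>"
proof (induction n)
  case 0
  then show ?case
    by (simp add: comb_seq_0 slope_def intercept_def)
next
  case (Suc n)
  interpret SS: pair_prob_space S S ..
  interpret MS: pair_prob_space M S ..
  have "AE s in M. AE \<omega> in S. \<phi> (case_nat s \<omega>) = fst s * \<phi> \<omega> + snd s"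
    using MS.AE_pair[OF \<phi>_case_nat] by simp
  \<comment> \<open>The one-step identity is applied to
    \<open>comb_seq n \<omega> \<omega>'\<close>, which again has law \<open>S\<close>.\<close>
  then have step: "AE s in M. AE \<omega> in S. AE \<omega>' in S.
      \<phi> (case_nat s (comb_seq n \<omega> \<omega>')) = fst s * \<phi> (comb_seq n \<omega> \<omega>') + snd s"
  proof eventually_elim
    case (elim s)
    then show ?case
      using SS.AE_pair[OF AE_comb_seqD] by simp
  qed
  have "AE s in M. AE \<omega> in S. AE \<omega>' in S. \<phi> (comb_seq (Suc n) (case_nat s \<omega>) \<omega>') =
      slope (Suc n) (case_nat s \<omega>) * \<phi> \<omega>' + intercept (Suc n) (case_nat s \<omega>)"
    using step
  proof eventually_elim
    case (elim s)
    with Suc.IH show ?case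
    proof eventually_elim
      case (elim \<omega>)
      then show ?case
        by eventually_elim
          (simp add: case_nat_comb_seq' slope_case_nat intercept_case_nat algebra_simps
            flip: case_nat_comb_seq')
    qed
  qed
  moreover have "Measurable.pred S (\<lambda>\<omega>. AE \<omega>' in S.
      \<phi> (comb_seq (Suc n) \<omega> \<omega>') = slope (Suc n) \<omega> * \<phi> \<omega>' + intercept (Suc n) \<omega>)" (is "Measurable.pred S ?Q")
    by (rule P.pred_AE_pair) measurable
  moreover from this have "Measurable.pred (M \<Otimes>\<^sub>M S) (\<lambda>x. ?Q (case_nat (fst x) (snd x)))"
    by (rule measurable_compose[rotated]) measurable
  ultimately have "AE x in M \<Otimes>\<^sub>M S. ?Q (case_nat (fst x) (snd x))"
    by (intro MS.AE_pair_measure predE) simp_all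
  then show ?case
    using \<open>Measurable.pred S ?Q\<close> by (simp add: AE_case_nat_iff case_prod_unfold)
qed

text \<open>Where the slope is at least \<open>1\<close>, the preimage of the short interval has measure at most \<open>1/2\<close>, so
  resampling the later steps leaves the level set with probability at least \<open>1/2\<close>.\<close>

lemma slope_ge_1_on_level_tendsto_0:
  assumes "0 < \<delta>" and small: "\<And>x. measure (distr S borel \<phi>) {x..x+\<delta>} \<le> 1 / 2"
  shows "(\<lambda>n. measure S {\<omega> \<in> space S. \<phi> \<omega> \<in> {c..<c+\<delta>} \<and> 1 \<le> slope n \<omega>}) \<longlonglongrightarrow> 0"
proof (rule tendsto_sandwich[of "\<lambda>_. 0"])
  interpret SS: pair_prob_space S S ..
  note [measurable] = measurable_comb_seq
  let ?J = "{c..<c+\<delta>}"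
  let ?A = "{\<omega> \<in> space S. \<phi> \<omega> \<in> ?J}"
  let ?E = "\<lambda>n. {\<omega> \<in> space S. \<phi> \<omega> \<in> ?J \<and> 1 \<le> slope n \<omega>}"
  let ?d = "\<lambda>n. {x \<in> space (S \<Otimes>\<^sub>M S). (case_prod (comb_seq n) x \<in> ?A) \<noteq> (fst x \<in> ?A)}"
  have "(\<lambda>n. measure (S \<Otimes>\<^sub>M S) (?d n)) \<longlonglongrightarrow> 0"
    by (rule comb_seq_converges_in_prob) measurable
  then show "(\<lambda>n. 2 * measure (S \<Otimes>\<^sub>M S) (?d n)) \<longlonglongrightarrow> 0"
    using tendsto_mult_right_zero by blast
  have "measure S (?E n) \<le> 2 * measure (S \<Otimes>\<^sub>M S) (?d n)" for n
  proof -
    \<comment> \<open>A lower bound for each section of \<open>?d n\<close>; integrating it over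
      \<omega> gives the bound on the product measure.\<close>
    have half: "ennreal (1/2) * indicator (?E n) \<omega> \<le> emeasure S (Pair \<omega> -` ?d n)"
      if ae: "AE \<omega>' in S. \<phi> (comb_seq n \<omega> \<omega>') = slope n \<omega> * \<phi> \<omega>' + intercept n \<omega>"
        and [measurable]: "\<omega> \<in> space S" for \<omega>
    proof (cases "\<omega> \<in> ?E n")
      case True
      \<comment> \<open>The left end of the preimage of \<open>?J\<close> under the affine map of
        the first \<open>n\<close> steps. The preimage has length \<delta> divided by the slope,
        hence at most \<delta>.\<close>
      define x where "x = (c - intercept n \<omega>) / slope n \<omega>"
      have slope: "1 \<le> slope n \<omega>" using True by simp
      have x: "y \<in> {x..x+\<delta>}" if "slope n \<omega> * y + intercept n \<omega> \<in> ?J" for y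
      proof -
        have *: "\<delta> \<le> slope n \<omega> * \<delta>" using slope \<open>0 < \<delta>\<close> by simp
        have J: "c \<le> slope n \<omega> * y + intercept n \<omega>" "slope n \<omega> * y + intercept n \<omega> < c + \<delta>"
          using that by auto
        have x_eq: "slope n \<omega> * x = c - intercept n \<omega>"
          using slope by (simp add: x_def)
        have "slope n \<omega> * x \<le> slope n \<omega> * y"
          unfolding x_eq using J by linarith
        moreover have "slope n \<omega> * y \<le> slope n \<omega> * (x + \<delta>)"
          unfolding distrib_left x_eq using J * by linarith
        ultimately show ?thesis
          using slope by simp
      qed
      have "measure S {\<omega>' \<in> space S. \<phi> \<omega>' \<in> {x..x+\<delta>}} \<le> 1 / 2"
        using small[of x] by (simp add: measure_distr vimage_def Int_def conj_commute)
      then have "1 / 2 \<le> measure S (space S - {\<omega>' \<in> space S. \<phi> \<omega>' \<in> {x..x+\<delta>}})"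
        by (subst P.prob_compl) auto
      also have "\<dots> \<le> measure S (Pair \<omega> -` ?d n)"
      proof (rule P.finite_measure_mono_AE)
        show "AE \<omega>' in S. \<omega>' \<in> space S - {\<omega>' \<in> space S. \<phi> \<omega>' \<in> {x..x+\<delta>}} \<longrightarrow> \<omega>' \<in> Pair \<omega> -` ?d n"
          using ae AE_space
        proof eventually_elim
          case (elim \<omega>')
          then show ?case
            using True x[of "\<phi> \<omega>'"] by (auto simp: space_pair_measure)
        qed
        show "Pair \<omega> -` ?d n \<in> sets S"
          by (rule sets_Pair1) measurable
      qed
      finally have "ennreal (1/2) \<le> emeasure S (Pair \<omega> -` ?d n)"
        unfolding P.emeasure_eq_measure by (rule ennreal_leI)
      then show ?thesis
        using True by (simp only: indicator_simps mult_1_right)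
    qed simp
    have *: "AE \<omega> in S. ennreal (1/2) * indicator (?E n) \<omega> \<le> emeasure S (Pair \<omega> -` ?d n)"
      using \<phi>_comb_seq[of n] AE_space
    proof eventually_elim
      case (elim \<omega>)
      then show ?case by (rule half)
    qed
    have "ennreal (1/2) * emeasure S (?E n) = (\<integral>\<^sup>+\<omega>. ennreal (1/2) * indicator (?E n) \<omega> \<partial>S)"
      by (rule nn_integral_cmult_indicator[symmetric]) measurable
    also have "\<dots> \<le> (\<integral>\<^sup>+\<omega>. emeasure S (Pair \<omega> -` ?d n) \<partial>S)"
      using * by (rule nn_integral_mono_AE)
    also have "\<dots> = emeasure (S \<Otimes>\<^sub>M S) (?d n)"
      by (rule P.emeasure_pair_measure_alt[symmetric]) measurable
    finally show ?thesis
      by (simp add: P.emeasure_eq_measure SS.emeasure_eq_measure ennreal_mult[symmetric] del: ennreal_half)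
  qed
  then show "eventually (\<lambda>n. measure S (?E n) \<le> 2 * measure (S \<Otimes>\<^sub>M S) (?d n)) sequentially"
    by simp
qed simp_all

text \<open>Cut the line into levels of length \<delta>. Finitely many of them carry all but
  \<open>e / 2\<close> of the law of \<phi>, and on each of these the probability tends to
  0.\<close>

lemma slope_ge_1_tendsto_0:
  assumes "0 < \<delta>" and small: "\<And>x. measure (distr S borel \<phi>) {x..x+\<delta>} \<le> 1 / 2"
  shows "(\<lambda>n. measure S {\<omega> \<in> space S. 1 \<le> slope n \<omega>}) \<longlonglongrightarrow> 0"
proof (rule LIMSEQ_I)
  fix e :: real assume e: "0 < e"
  let ?T = "\<lambda>N::nat. {\<omega> \<in> space S. real N * \<delta> \<le> \<bar>\<phi> \<omega>\<bar>}"
  let ?E = "\<lambda>n k. {\<omega> \<in> space S. \<phi> \<omega> \<in> {real_of_int k * \<delta>..<real_of_int k * \<delta> + \<delta>} \<and> 1 \<le> slope n \<omega>}"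
  have "(\<lambda>N. measure S (?T N)) \<longlonglongrightarrow> measure S (\<Inter>N. ?T N)"
  proof (rule P.finite_Lim_measure_decseq)
    have "real N * \<delta> \<le> real N' * \<delta>" if "N \<le> N'" for N N'
      using that \<open>0 < \<delta>\<close> by simp
    then show "decseq ?T"
      unfolding decseq_def by (blast intro: order_trans)
    show "range ?T \<subseteq> sets S"
      by (intro image_subsetI) measurable
  qed
  moreover have "(\<Inter>N. ?T N) = {}"
  proof -
    have "\<exists>N. \<omega> \<notin> ?T N" for \<omega>
      using reals_Archimedean3[OF \<open>0 < \<delta>\<close>] by (simp add: not_le)
    then show ?thesis
      by blast
  qed
  ultimately have "(\<lambda>N. measure S (?T N)) \<longlonglongrightarrow> 0"
    by simp
  then obtain N where N: "measure S (?T N) < e / 2"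
    using order_tendstoD(2)[of _ 0 sequentially "e / 2"] e by (auto simp: eventually_sequentially)
  let ?K = "{- int N..int N}"
  have "(\<lambda>n. \<Sum>k\<in>?K. measure S (?E n k)) \<longlonglongrightarrow> (\<Sum>k\<in>?K. 0)"
    by (intro tendsto_sum slope_ge_1_on_level_tendsto_0 assms)
  then obtain n0 where n0: "\<And>n. n0 \<le> n \<Longrightarrow> (\<Sum>k\<in>?K. measure S (?E n k)) < e / 2"
    using order_tendstoD(2)[of _ 0 sequentially "e / 2"] e by (auto simp: eventually_sequentially)
  have "measure S {\<omega> \<in> space S. 1 \<le> slope n \<omega>} < e" if "n0 \<le> n" for n
  proof -
    have "\<omega> \<in> (\<Union>k\<in>?K. ?E n k) \<union> ?T N" if "\<omega> \<in> space S" "1 \<le> slope n \<omega>" for \<omega>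
    proof (cases "\<omega> \<in> ?T N")
      case False
      define k where "k = \<lfloor>\<phi> \<omega> / \<delta>\<rfloor>"
      have "real_of_int k \<le> \<phi> \<omega> / \<delta>" "\<phi> \<omega> / \<delta> < real_of_int k + 1"
        by (auto simp: k_def)
      then have k: "\<phi> \<omega> \<in> {real_of_int k * \<delta>..<real_of_int k * \<delta> + \<delta>}"
        using \<open>0 < \<delta>\<close> by (auto simp: field_simps)
      have "\<bar>\<phi> \<omega> / \<delta>\<bar> < real N"
        using False that \<open>0 < \<delta>\<close> by (simp add: field_simps)
      then have "k \<in> ?K"
        unfolding k_def by (simp, linarith)
      with k that show ?thesis by blast
    qed simp
    then have "measure S {\<omega> \<in> space S. 1 \<le> slope n \<omega>} \<le> measure S ((\<Union>k\<in>?K. ?E n k) \<union> ?T N)"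
      by (intro P.finite_measure_mono subsetI) (simp_all, measurable)
    also have "\<dots> \<le> measure S (\<Union>k\<in>?K. ?E n k) + measure S (?T N)"
      by (intro measure_Un_le) measurable
    also have "\<dots> \<le> (\<Sum>k\<in>?K. measure S (?E n k)) + measure S (?T N)"
      by (intro add_mono measure_UNION_le order_refl) measurable
    also have "\<dots> < e"
      using n0[OF that] N by simp
    finally show ?thesis .
  qed
  then show "\<exists>no. \<forall>n\<ge>no. norm (measure S {\<omega> \<in> space S. 1 \<le> slope n \<omega>} - 0) < e"
    by auto
qed

end

text \<open>Inverting every step preserves the law of the walk and turns the slope into its
  reciprocal; the order of the steps does not matter for slopes. So the events that the slope is at
  least 1 and at most 1 are equally likely, and together they exhaust the space.\<close>

lemma symmetric_slope_ge_1:
  assumes "prob_space \<mu>" and sets: "sets \<mu> = sets (borel_of axb_topology)"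
    and sym: "symmetric_measure axb_group \<mu>"
  shows "1 / 2 \<le> measure (walk_space \<mu>) {\<omega> \<in> space (walk_space \<mu>). 1 \<le> slope n \<omega>}"
proof -
  interpret \<mu>: prob_space \<mu> by fact
  interpret sequence_space \<mu> by unfold_locales
  note [measurable] = fst_snd_measurable_axb[OF sets]
  have space: "space \<mu> = carrier axb_group"
    using sets_eq_imp_space_eq[OF sets] by (simp add: space_borel_of_axb_topology)
  have S: "walk_space \<mu> = S"
    by (simp add: walk_space_def)
  have [measurable]: "slope n \<in> borel_measurable S"
    unfolding slope_def by measurable
  let ?inv = "\<lambda>\<omega> i. inv\<^bsub>axb_group\<^esub> (\<omega> i)"
  have inv: "(\<lambda>g. inv\<^bsub>axb_group\<^esub> g) \<in> \<mu> \<rightarrow>\<^sub>M \<mu>"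
  proof -
    have "(\<lambda>g. (1 / fst g, - snd g / fst g)) \<in> \<mu> \<rightarrow>\<^sub>M restrict_space borel (carrier axb_group)"
      unfolding borel_prod[symmetric]
      by (rule measurable_restrict_space2) (auto simp: space axb_group_def)
    then have "(\<lambda>g. (1 / fst g, - snd g / fst g)) \<in> \<mu> \<rightarrow>\<^sub>M \<mu>"
      using measurable_cong_sets[OF refl, of \<mu> "restrict_space borel (carrier axb_group)" \<mu>] sets
        sets_borel_of_axb_topology by simp
    then show ?thesis
      by (rule measurable_cong[THEN iffD1, rotated]) (simp add: space inv_axb_group)
  qed
  then have distr: "distr S S ?inv = S"
    using sym by (intro distr_componentwise) (simp_all add: symmetric_measure_def)
  have inv_S: "?inv \<in> S \<rightarrow>\<^sub>M S"
    using inv by (intro measurable_PiM_single') (auto simp: space_PiM intro: measurable_space)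
  have slope_inv: "slope n (?inv \<omega>) = 1 / slope n \<omega>" "0 < slope n \<omega>" if "\<omega> \<in> space S" for \<omega>
  proof -
    have \<omega>: "\<omega> i \<in> carrier axb_group" for i
      using that by (auto simp: space_PiM space)
    then show "slope n (?inv \<omega>) = 1 / slope n \<omega>"
      by (simp add: slope_def inv_axb_group prod_dividef)
    have "0 < fst (\<omega> i)" for i
      using \<omega>[of i] by (auto simp: axb_group_def)
    then show "0 < slope n \<omega>"
      by (simp add: slope_def prod_pos)
  qed
  let ?E = "{\<omega> \<in> space S. 1 \<le> slope n \<omega>}"
  have "measure S ?E = measure (distr S S ?inv) ?E"
    by (simp add: distr)
  also have "\<dots> = measure S (?inv -` ?E \<inter> space S)"
    by (rule measure_distr[OF inv_S]) measurable
  also have "?inv -` ?E \<inter> space S = {\<omega> \<in> space S. slope n \<omega> \<le> 1}"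
    using measurable_space[OF inv_S] slope_inv by auto
  finally have "measure S ?E = measure S {\<omega> \<in> space S. slope n \<omega> \<le> 1}" .
  moreover have "measure S (space S) \<le> measure S (?E \<union> {\<omega> \<in> space S. slope n \<omega> \<le> 1})"
    by (intro P.finite_measure_mono) auto
  moreover have "\<dots> \<le> measure S ?E + measure S {\<omega> \<in> space S. slope n \<omega> \<le> 1}"
    by (intro measure_Un_le) measurable
  ultimately show ?thesis
    by (simp add: P.prob_space S)
qed

section \<open>Short intervals under \<open>lam\<close>, and affine walks from the Poisson
  boundary\<close>

lemma small_intervals:
  assumes "prob_space (lam :: real measure)" and "sets lam = sets borel"
    and "null_sets lam = null_sets lborel"
  obtains \<delta> where "0 < \<delta>" "\<And>x. measure lam {x..x+\<delta>} \<le> 1 / 2"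
proof -
  interpret prob_space lam by fact
  have ac: "absolutely_continuous lborel lam"
    by (simp add: absolutely_continuous_def assms(3))
  obtain d where d: "0 < d"
    "\<And>A. A \<in> sets lborel \<Longrightarrow> emeasure lborel A < ennreal d \<Longrightarrow> measure lam A < 1 / 2"
    using uniform_absolute_continuity[OF finite_measure_axioms _ ac, of "1 / 2"] assms(2) by auto
  have "measure lam {x..x + d / 2} < 1 / 2" for x
    by (rule d(2)) (use d(1) in \<open>auto simp: ennreal_less_iff\<close>)
  then show ?thesis
    using d(1) by (intro that[of "d / 2"]) (auto intro: less_imp_le)
qed

text \<open>The function is \<pi> composed with the projection \<open>p\<close>. Invariance of
  \<open>p\<close> under \<open>walk_T\<close> turns prepending a step \<open>s\<close> into acting
  by \<open>s\<close>, and equivariance of \<open>p\<close> and \<pi> carries this action to the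
  line.\<close>

lemma poisson_boundary_G_map_equivariant:
  assumes "prob_space \<mu>" and sets: "sets \<mu> = sets (borel_of axb_topology)"
    and sets_lam: "sets lam = sets borel"
    and pb: "poisson_boundary axb_group axb_topology \<mu> P act"
    and \<pi>: "G_map axb_group P act lam axb_act \<pi>"
  obtains \<phi> where "\<phi> \<in> borel_measurable (walk_space \<mu>)" "distr (walk_space \<mu>) borel \<phi> = lam"
    "AE (s, \<omega>) in \<mu> \<Otimes>\<^sub>M walk_space \<mu>. \<phi> (case_nat s \<omega>) = fst s * \<phi> \<omega> + snd s"
proof -
  interpret \<mu>: prob_space \<mu> by fact
  interpret sequence_space \<mu> by unfold_locales
  interpret MS: pair_prob_space \<mu> S ..
  interpret G: group axb_group by (rule group_axb_group)
  note [measurable] = fst_snd_measurable_axb[OF sets]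
  have space: "space \<mu> = carrier axb_group"
    using sets_eq_imp_space_eq[OF sets] by (simp add: space_borel_of_axb_topology)
  have S: "walk_space \<mu> = S"
    by (simp add: walk_space_def)
  obtain p where p: "ergodic_components axb_group \<mu> P p"
    and p_act: "\<And>g. g \<in> carrier axb_group \<Longrightarrow>
      walk_AE axb_group \<mu> (\<lambda>\<omega>. p (walk_act axb_group g \<omega>) = act g (p \<omega>))"
    using pb by (auto simp: poisson_boundary_def)
  have p_meas: "p \<in> S \<rightarrow>\<^sub>M P" and p_distr: "distr S P p = P"
    and p_T: "walk_AE axb_group \<mu> (\<lambda>\<omega>. p (walk_T axb_group \<omega>) = p \<omega>)"
    using p by (auto simp: ergodic_components_def S)
  have \<pi>_meas: "\<pi> \<in> P \<rightarrow>\<^sub>M lam" and \<pi>_distr: "distr P lam \<pi> = lam"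
    and \<pi>_act: "\<And>g. g \<in> carrier axb_group \<Longrightarrow> AE x in P. \<pi> (act g x) = axb_act g (\<pi> x)"
    using \<pi> by (auto simp: G_map_def)
  \<comment> \<open>Specializing the translate to the identity recovers almost sure statements for
    the walk itself.\<close>
  have walk_AE_D: "AE \<omega> in S. Q \<omega>" if "walk_AE axb_group \<mu> Q" for Q
  proof -
    have "AE \<omega> in S. Q (walk_act axb_group \<one>\<^bsub>axb_group\<^esub> \<omega>)"
      by (rule bspec[OF that[unfolded walk_AE_def S] G.one_closed])
    then show ?thesis
      using AE_space
    proof eventually_elim
      case (elim \<omega>)
      then have "\<omega> 0 \<in> carrier axb_group"
        by (auto simp: space_PiM space)
      then show ?case
        using elim by (simp add: walk_act_def)
    qed
  qed
  define \<phi> where "\<phi> \<omega> = \<pi> (p \<omega>)" for \<omega>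
  have \<phi>: "\<phi> \<in> S \<rightarrow>\<^sub>M lam" "distr S lam \<phi> = lam"
    using measurable_comp[OF p_meas \<pi>_meas] distr_distr[OF \<pi>_meas p_meas] p_distr \<pi>_distr
    by (simp_all add: \<phi>_def[abs_def] o_def)
  have \<phi>_meas [measurable]: "\<phi> \<in> borel_measurable S"
    using \<phi>(1) measurable_cong_sets[OF refl sets_lam, of S] by simp
  have law: "distr S borel \<phi> = lam"
    using \<phi>(2) sets_lam by (metis distr_cong)
  have \<phi>_act: "AE \<omega> in S. \<phi> (walk_act axb_group g \<omega>) = axb_act g (\<phi> \<omega>)" if "g \<in> carrier axb_group" for g
  proof -
    have "AE \<omega> in S. \<pi> (act g (p \<omega>)) = axb_act g (\<pi> (p \<omega>))"
      by (rule AE_distrD[OF p_meas]) (unfold p_distr, rule \<pi>_act[OF that])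
    with walk_AE_D[OF p_act[OF that]] show ?thesis
      by eventually_elim (simp add: \<phi>_def)
  qed
  \<comment> \<open>\<open>walk_T\<close> multiplies the prepended step into the next one, which is
    the action of \<open>s\<close> on \<omega>.\<close>
  have T: "walk_T axb_group (case_nat s \<omega>) = walk_act axb_group s \<omega>" for s \<omega>
    by (auto simp: walk_T_def walk_act_def fun_eq_iff split: nat.split)
  have "AE (s, \<omega>) in \<mu> \<Otimes>\<^sub>M S. p (walk_T axb_group (case_nat s \<omega>)) = p (case_nat s \<omega>)"
    by (rule AE_case_natD[OF walk_AE_D[OF p_T]])
  then have "AE s in \<mu>. AE \<omega> in S. p (walk_act axb_group s \<omega>) = p (case_nat s \<omega>)"
    using MS.AE_pair by (fastforce simp: T)
  \<comment> \<open>The null set in \<open>\<phi>_act\<close> depends on \<open>s\<close>, so the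
    identity is first proved for each such \<open>s\<close>; measurability then merges the two
    quantifiers.\<close>
  then have "AE s in \<mu>. AE \<omega> in S. \<phi> (case_nat s \<omega>) = fst s * \<phi> \<omega> + snd s"
    using AE_space
  proof eventually_elim
    case (elim s)
    then have "s \<in> carrier axb_group"
      by (simp add: space)
    from elim(1) \<phi>_act[OF this] show ?case
      by eventually_elim (simp add: \<phi>_def axb_act_def case_prod_unfold)
  qed
  moreover have "Measurable.pred (\<mu> \<Otimes>\<^sub>M S) (\<lambda>(s, \<omega>). \<phi> (case_nat s \<omega>) = fst s * \<phi> \<omega> + snd s)"
    by measurable
  ultimately have "AE (s, \<omega>) in \<mu> \<Otimes>\<^sub>M S. \<phi> (case_nat s \<omega>) = fst s * \<phi> \<omega> + snd s"
    by (intro MS.AE_pair_measure predE) simp_all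
  with law show ?thesis
    using that \<phi>_meas unfolding S by blast
qed

theorem theorem3p10:
  fixes lam :: "real measure"
  assumes "prob_space lam"
    and "sets lam = sets borel"
    and "null_sets lam = null_sets lborel"
  shows "contractive axb_group axb_topology lam axb_act \<and>
    (\<forall>(\<mu> :: (real \<times> real) measure) H (P :: 'p measure) act.
       prob_space \<mu> \<and> sets \<mu> = sets (borel_of axb_topology) \<and>
       symmetric_measure axb_group \<mu> \<and>
       haar_measure axb_group axb_topology H \<and> \<not> mutually_singular \<mu> H \<and>
       generate axb_group (measure_support axb_topology \<mu>) = carrier axb_group \<and>
       poisson_boundary axb_group axb_topology \<mu> P act
       \<longrightarrow> \<not> is_quotient axb_group axb_topology lam axb_act P act)"
proof (intro conjI allI impI notI)
  show "contractive axb_group axb_topology lam axb_act"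
    by (rule contractive_axb_act) fact+
next
  fix \<mu> :: "(real \<times> real) measure" and H and P :: "'p measure" and act
  assume \<mu>: "prob_space \<mu> \<and> sets \<mu> = sets (borel_of axb_topology) \<and>
       symmetric_measure axb_group \<mu> \<and>
       haar_measure axb_group axb_topology H \<and> \<not> mutually_singular \<mu> H \<and>
       generate axb_group (measure_support axb_topology \<mu>) = carrier axb_group \<and>
       poisson_boundary axb_group axb_topology \<mu> P act"
    and "is_quotient axb_group axb_topology lam axb_act P act"
  then obtain \<pi> where \<pi>: "G_map axb_group P act lam axb_act \<pi>"
    by (auto simp: is_quotient_def)
  interpret \<mu>: prob_space \<mu> using \<mu> by blast
  obtain \<phi> where \<phi>: "\<phi> \<in> borel_measurable (walk_space \<mu>)" "distr (walk_space \<mu>) borel \<phi> = lam"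
    "AE (s, \<omega>) in \<mu> \<Otimes>\<^sub>M walk_space \<mu>. \<phi> (case_nat s \<omega>) = fst s * \<phi> \<omega> + snd s"
    using \<mu> by (elim conjE) (rule poisson_boundary_G_map_equivariant[OF _ _ assms(2) _ \<pi>])
  have sets_\<mu>: "sets \<mu> = sets (borel_of axb_topology)"
    using \<mu> by blast
  interpret affine_walk \<mu> \<phi>
    by unfold_locales (fact fst_snd_measurable_axb[OF sets_\<mu>] \<phi>[unfolded walk_space_def])+
  \<comment> \<open>One \<delta> must serve all \<open>x\<close>, since the preimage intervals in
    the walk argument move with the steps.\<close>
  obtain \<delta> where "0 < \<delta>" "\<And>x. measure lam {x..x+\<delta>} \<le> 1 / 2"
    using small_intervals[OF assms] by blast
  then have lim: "(\<lambda>n. measure (walk_space \<mu>) {\<omega> \<in> space (walk_space \<mu>). 1 \<le> slope n \<omega>}) \<longlonglongrightarrow> 0"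
    unfolding walk_space_def \<phi>(2)[symmetric] by (rule slope_ge_1_tendsto_0)
  have "1 / 2 \<le> measure (walk_space \<mu>) {\<omega> \<in> space (walk_space \<mu>). 1 \<le> slope n \<omega>}" for n
    using \<mu> by (intro symmetric_slope_ge_1) auto
  then show False
    using LIMSEQ_le_const[OF lim, of "1 / 2"] by simp
qed

end
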